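(* Let $G_1$ be an $r_1$-regular graph with $n_1$ vertices and $G_2$ an $r_2$-regular graph with $n_2$ vertices. Then the signless Laplacian spectrum (with multiplicities) of $G_1\underset{=}{\vee}G_2$ consists of: - $n_1+\nu_j(G_2)$ for each $j=2,3,\dots,n_2$; - the two roots of the equation $$x^2+(2r_1-2n_1-n_2-\nu_i(G_1)+2)x+n_1^2-2r_1n_1-2n_1+n_1n_2-r_1n_2-n_2+4r_1+\nu_i(G_1)\big(n_1+r_1-3-\nu_i(G_1)\big)=0$$ for each $i=2,3,\dots,n_1$; - the three roots of the equation $$\begin{aligned}&x^3+(2-3n_1-n_2-2r_2)x^2\\&+(n_1n_2-n_2r_1-n_2+2n_1^2+2r_1n_1-2n_1-2r_1-2r_1^2+4r_2n_1-4r_2+2r_2n_2)x\\&+2n_1r_1^2+2r_1n_1-2r_1n_1^2-2r_2n_1n_2+2r_1r_2n_2+2r_2n_2+4r_2r_1^2+4r_1r_2-4r_1r_2n_1=0.\end{aligned}$$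
   Context: Graphs are finite, undirected and simple. With $A(G)$ the adjacency matrix and $D(G)$ the diagonal degree matrix, $Q(G)=D(G)+A(G)$ is the signless Laplacian; $\nu_1(G)\ge\nu_2(G)\ge\dots\ge\nu_n(G)$ denote its eigenvalues, and the signless Laplacian spectrum is the multiset of these eigenvalues. For vertex-disjoint graphs $G_1$ (with $V(G_1)=\{u_1,\dots,u_{n_1}\}$) and $G_2$, the join $G_1\vee G_2$ is the disjoint union together with all edges between $V(G_1)$ and $V(G_2)$. The NNS (Non Neighbors Splitting) join $G_1\underset{=}{\vee}G_2$ is obtained from $G_1\vee G_2$ by adding new vertices $u_1',\dots,u_{n_1}'$ and joining $u_i'$ to $u_j$ if and only if $i\ne j$ and $u_iu_j\notin E(G_1)$. *)

theory Defs
  imports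
    "HOL-Computational_Algebra.Polynomial"
    "Jordan_Normal_Form.Char_Poly"
    "Jordan_Normal_Form.Conjugate"
    "Graph_Theory.Pair_Digraph"
begin

text \<open>Finite simple undirected graphs are \<^locale>\<open>pair_graph\<close>s: an undirected edge is represented
  by its two opposite arcs, so the degree of a vertex is its \<^const>\<open>out_degree\<close>.\<close>

definition regular_graph :: "nat \<Rightarrow> 'a pair_pre_digraph \<Rightarrow> bool" where
  "regular_graph r G \<longleftrightarrow> (\<forall>v \<in> pverts G. out_degree (with_proj G) v = r)"

definition graph_join ::
  "'a pair_pre_digraph \<Rightarrow> 'b pair_pre_digraph \<Rightarrow> ('a + 'b) pair_pre_digraph" where
  "graph_join G1 G2 = \<lparr>
     pverts = pverts G1 <+> pverts G2,
     parcs = {(Inl u, Inl v) | u v. (u, v) \<in> parcs G1}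
           \<union> {(Inr x, Inr y) | x y. (x, y) \<in> parcs G2}
           \<union> {(Inl u, Inr x) | u x. u \<in> pverts G1 \<and> x \<in> pverts G2}
           \<union> {(Inr x, Inl u) | u x. u \<in> pverts G1 \<and> x \<in> pverts G2} \<rparr>"

text \<open>The new vertex \<open>u'\<close> belonging to \<open>u \<in> pverts G1\<close> is \<open>Inr u\<close>; the vertices of the join are
  tagged with \<open>Inl\<close>.\<close>

definition nns_join ::
  "'a pair_pre_digraph \<Rightarrow> 'b pair_pre_digraph \<Rightarrow> (('a + 'b) + 'a) pair_pre_digraph" where
  "nns_join G1 G2 = \<lparr>
     pverts = pverts (graph_join G1 G2) <+> pverts G1,
     parcs = {(Inl x, Inl y) | x y. (x, y) \<in> parcs (graph_join G1 G2)}
           \<union> {(Inr u, Inl (Inl v)) | u v.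
                u \<in> pverts G1 \<and> v \<in> pverts G1 \<and> u \<noteq> v \<and> (u, v) \<notin> parcs G1}
           \<union> {(Inl (Inl v), Inr u) | u v.
                u \<in> pverts G1 \<and> v \<in> pverts G1 \<and> u \<noteq> v \<and> (u, v) \<notin> parcs G1} \<rparr>"

text \<open>Rows and columns are indexed along an enumeration \<open>vs\<close> of the vertices.\<close>

definition adjacency_mat :: "'a list \<Rightarrow> 'a pair_pre_digraph \<Rightarrow> real mat" where
  "adjacency_mat vs G = mat (length vs) (length vs)
     (\<lambda>(i, j). if (vs ! i, vs ! j) \<in> parcs G then 1 else 0)"

definition degree_mat :: "'a list \<Rightarrow> 'a pair_pre_digraph \<Rightarrow> real mat" where
  "degree_mat vs G = mat (length vs) (length vs)
     (\<lambda>(i, j). if i = j then real (out_degree (with_proj G) (vs ! i)) else 0)"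

definition signless_laplacian :: "'a list \<Rightarrow> 'a pair_pre_digraph \<Rightarrow> real mat" where
  "signless_laplacian vs G = degree_mat vs G + adjacency_mat vs G"

definition vertex_list :: "'a pair_pre_digraph \<Rightarrow> 'a list" where
  "vertex_list G = (SOME vs. distinct vs \<and> set vs = pverts G)"

text \<open>The choice of enumeration is irrelevant (\<open>sl_spectrum_eq\<close> below), and taking real roots loses
  no eigenvalue (\<open>size_sl_spectrum\<close> below).\<close>

definition sl_spectrum :: "'a pair_pre_digraph \<Rightarrow> real multiset" where
  "sl_spectrum G = proots (char_poly (signless_laplacian (vertex_list G) G))"

definition sl_eigenvalue :: "'a pair_pre_digraph \<Rightarrow> nat \<Rightarrow> real" (\<open>\<nu>\<close>) where
  "\<nu> G i = rev (sorted_list_of_multiset (sl_spectrum G)) ! (i - 1)"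
  \<comment> \<open>non-increasing order, indices \<open>i\<close> starting at \<open>1\<close>\<close>

lemma vertex_list:
  assumes "finite (pverts G)"
  shows "distinct (vertex_list G)" "set (vertex_list G) = pverts G"
proof -
  have "distinct (vertex_list G) \<and> set (vertex_list G) = pverts G"
    unfolding vertex_list_def by (rule someI_ex) (use finite_distinct_list[OF assms] in blast)
  then show "distinct (vertex_list G)" "set (vertex_list G) = pverts G" by auto
qed

lemma signless_laplacian_carrier:
  "signless_laplacian vs G \<in> carrier_mat (length vs) (length vs)"
  by (simp add: signless_laplacian_def degree_mat_def adjacency_mat_def)

lemma sum_nth_delta:
  assumes "distinct ws" "v \<in> set ws"
  shows "(\<Sum>k = 0..<length ws. (if v = ws ! k then f k else 0) :: 'c :: comm_monoid_add)
       = f (THE k. k < length ws \<and> ws ! k = v)"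
proof -
  obtain m where m: "m < length ws" "ws ! m = v" using assms(2) by (auto simp: in_set_conv_nth)
  have the: "(THE k. k < length ws \<and> ws ! k = v) = m"
    using m assms(1) by (auto simp: nth_eq_iff_index_eq)
  have "(\<Sum>k = 0..<length ws. if v = ws ! k then f k else 0)
      = (\<Sum>k = 0..<length ws. if k = m then f k else 0)"
    by (rule sum.cong) (use m assms(1) in \<open>auto simp: nth_eq_iff_index_eq\<close>)
  also have "\<dots> = f m" using m by simp
  finally show ?thesis unfolding the .
qed

lemma signless_laplacian_similar:
  assumes "distinct vs" "distinct ws" "set vs = set ws"
  shows "similar_mat (signless_laplacian vs G) (signless_laplacian ws G)"
proof -
  define n where "n = length vs"
  have n: "length vs = n" "length ws = n"
    using assms by (auto simp: n_def) (metis distinct_card)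
  define P :: "'a list \<Rightarrow> 'a list \<Rightarrow> real mat"
    where "P xs ys = mat n n (\<lambda>(i, j). if xs ! i = ys ! j then 1 else 0)" for xs ys
  have P: "P xs ys \<in> carrier_mat n n" for xs ys by (simp add: P_def)
  define pos where "pos xs v = (THE k. k < n \<and> xs ! k = v)" for xs :: "'a list" and v
  have pos: "pos xs v < n \<and> xs ! pos xs v = v"
    if d: "distinct xs" "v \<in> set xs" "length xs = n" for xs v
  proof -
    obtain m where "m < n" "xs ! m = v" using d by (auto simp: in_set_conv_nth)
    moreover from this have "pos xs v = m"
      using d unfolding pos_def by (auto simp: nth_eq_iff_index_eq)
    ultimately show ?thesis by simp
  qed
  have mult: "(P xs ys * B) $$ (i, j) = B $$ (pos ys (xs ! i), j)"
    if "distinct ys" "set xs = set ys" "length xs = n" "length ys = n"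
      "B \<in> carrier_mat n n" "i < n" "j < n" for xs ys B i j
  proof -
    have "(P xs ys * B) $$ (i, j) = (\<Sum>k = 0..<length ys. if xs ! i = ys ! k then B $$ (k, j) else 0)"
      using that(3-7) by (auto simp: P_def scalar_prod_def intro!: sum.cong)
    also have "\<dots> = B $$ (pos ys (xs ! i), j)"
      using sum_nth_delta[OF that(1), of "xs ! i"] that(2,3,4,6,7) nth_mem[of i xs]
      by (simp add: pos_def)
    finally show ?thesis .
  qed
  have multr: "(B * P ys xs) $$ (i, j) = B $$ (i, pos ys (xs ! j))"
    if "distinct ys" "set xs = set ys" "length xs = n" "length ys = n"
      "B \<in> carrier_mat n n" "i < n" "j < n" for xs ys B i j
  proof -
    have "(B * P ys xs) $$ (i, j) = (\<Sum>k = 0..<length ys. if xs ! j = ys ! k then B $$ (i, k) else 0)"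
      using that(3-7) by (auto simp: P_def scalar_prod_def intro!: sum.cong)
    also have "\<dots> = B $$ (i, pos ys (xs ! j))"
      using sum_nth_delta[OF that(1), of "xs ! j"] that(2,3,4,6,7) nth_mem[of j xs]
      by (simp add: pos_def)
    finally show ?thesis .
  qed
  have inv: "P xs ys * P ys xs = 1\<^sub>m n"
    if d: "distinct xs" "distinct ys" "set xs = set ys" "length xs = n" "length ys = n" for xs ys
  proof (rule eq_matI)
    fix i j assume ij: "i < dim_row (1\<^sub>m n :: real mat)" "j < dim_col (1\<^sub>m n :: real mat)"
    have "xs ! i \<in> set ys" using ij d nth_mem[of i xs] by simp
    then have k: "pos ys (xs ! i) < n" "ys ! pos ys (xs ! i) = xs ! i"
      using pos[OF d(2) _ d(5), of "xs ! i"] by simp_all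
    have ij': "i < n" "j < n" using ij by auto
    have "(P xs ys * P ys xs) $$ (i, j) = P ys xs $$ (pos ys (xs ! i), j)"
      by (rule mult[OF d(2,3,4,5) P ij'])
    also have "\<dots> = (if xs ! i = xs ! j then 1 else 0)" using k ij' by (simp add: P_def)
    also have "\<dots> = 1\<^sub>m n $$ (i, j)" using d(1,4) ij' by (simp add: nth_eq_iff_index_eq)
    finally show "(P xs ys * P ys xs) $$ (i, j) = 1\<^sub>m n $$ (i, j)" .
  qed (auto simp: P_def)
  let ?A = "signless_laplacian vs G" and ?B = "signless_laplacian ws G"
  have A: "?A \<in> carrier_mat n n" and B: "?B \<in> carrier_mat n n"
    using signless_laplacian_carrier[of vs G] signless_laplacian_carrier[of ws G] n by simp_all
  have "?A = P vs ws * ?B * P ws vs"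
  proof (rule eq_matI)
    fix i j assume "i < dim_row (P vs ws * ?B * P ws vs)" "j < dim_col (P vs ws * ?B * P ws vs)"
    then have ij: "i < n" "j < n" by (auto simp: P_def)
    let ?i = "pos ws (vs ! i)" and ?j = "pos ws (vs ! j)"
    have "vs ! i \<in> set ws" "vs ! j \<in> set ws" using ij n assms(3) nth_mem[of i vs] nth_mem[of j vs] by simp_all
    then have k: "?i < n" "ws ! ?i = vs ! i" "?j < n" "ws ! ?j = vs ! j"
      using pos[OF assms(2) _ n(2), of "vs ! i"] pos[OF assms(2) _ n(2), of "vs ! j"] by simp_all
    have eq: "?i = ?j \<longleftrightarrow> i = j"
    proof
      assume "?i = ?j"
      then have "ws ! ?i = ws ! ?j" by (rule arg_cong)
      then have "vs ! i = vs ! j" unfolding k .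
      then show "i = j" using nth_eq_iff_index_eq[OF assms(1)] ij n by simp
    qed simp
    have "(P vs ws * ?B * P ws vs) $$ (i, j) = (P vs ws * ?B) $$ (i, ?j)"
      by (rule multr[OF assms(2,3) n _ ij]) (rule mult_carrier_mat[OF P B])
    also have "\<dots> = ?B $$ (?i, ?j)"
      by (rule mult[OF assms(2,3) n B ij(1) k(3)])
    also have "\<dots> = ?A $$ (i, j)"
      using k ij n eq
      by (simp add: signless_laplacian_def degree_mat_def adjacency_mat_def)
    finally show "?A $$ (i, j) = (P vs ws * ?B * P ws vs) $$ (i, j)" by simp
  qed (use A in \<open>auto simp: P_def\<close>)
  moreover have "P vs ws * P ws vs = 1\<^sub>m n" "P ws vs * P vs ws = 1\<^sub>m n"
    by (rule inv[OF assms n], rule inv[OF assms(2,1) assms(3)[symmetric] n(2,1)])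
  moreover have "{?A, ?B, P vs ws, P ws vs} \<subseteq> carrier_mat n n" using A B P by blast
  ultimately show ?thesis by (intro similar_matI)
qed

lemma sl_spectrum_eq:
  assumes "distinct vs" "set vs = pverts G"
  shows "proots (char_poly (signless_laplacian vs G)) = sl_spectrum G"
proof -
  have "finite (pverts G)" using assms(2) by (metis List.finite_set)
  then have "similar_mat (signless_laplacian vs G) (signless_laplacian (vertex_list G) G)"
    using assms by (intro signless_laplacian_similar) (auto simp: vertex_list)
  then show ?thesis by (simp add: sl_spectrum_def char_poly_similar)
qed

lemma real_symmetric_eigenvalue_real:
  fixes A :: "real mat"
  assumes A: "A \<in> carrier_mat n n" and sym: "A\<^sup>T = A"
    and ev: "eigenvalue (map_mat complex_of_real A) k"
  shows "k \<in> \<real>"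
proof -
  let ?C = "map_mat complex_of_real A"
  have C: "?C \<in> carrier_mat n n" using A by simp
  obtain v where v: "v \<in> carrier_vec n" "v \<noteq> 0\<^sub>v n" "?C *\<^sub>v v = k \<cdot>\<^sub>v v"
    using ev C unfolding eigenvalue_def eigenvector_def by auto
  have symC: "?C\<^sup>T = ?C" using sym by (metis map_mat_transpose)
  have cv: "conjugate v \<in> carrier_vec n" using v by simp
  have conj: "conjugate (?C *\<^sub>v v) = ?C *\<^sub>v conjugate v"
    using A v(1) by (intro eq_vecI) (auto simp: scalar_prod_def)
  have "k * (v \<bullet>c v) = (?C *\<^sub>v v) \<bullet>c v" using v by simp
  also have "\<dots> = v \<bullet> (?C *\<^sub>v conjugate v)"
    using transpose_vec_mult_scalar[OF C cv v(1)] symC by simp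
  also have "\<dots> = v \<bullet> conjugate (k \<cdot>\<^sub>v v)" using conj v by simp
  also have "\<dots> = cnj k * (v \<bullet>c v)" using v by (simp add: conjugate_smult_vec)
  finally have "k * (v \<bullet>c v) = cnj k * (v \<bullet>c v)" .
  moreover have "v \<bullet>c v \<noteq> 0" using v by simp
  ultimately show ?thesis by (simp add: Reals_cnj_iff)
qed

lemma real_symmetric_size_proots:
  fixes A :: "real mat"
  assumes A: "A \<in> carrier_mat n n" and sym: "A\<^sup>T = A"
  shows "size (proots (char_poly A)) = n"
proof -
  let ?C = "map_mat complex_of_real A"
  have C: "?C \<in> carrier_mat n n" using A by simp
  obtain as where as: "char_poly ?C = (\<Prod>a\<leftarrow>as. [:- a, 1:])" "length as = n"
    using char_poly_factorized[OF C] by blast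
  have "a \<in> \<real>" if "a \<in> set as" for a
  proof -
    have "poly (char_poly ?C) a = 0"
      unfolding as(1) using that by (auto simp: poly_prod_list prod_list_zero_iff)
    then show ?thesis
      using real_symmetric_eigenvalue_real[OF A sym] eigenvalue_root_char_poly[OF C] by blast
  qed
  then have as_Re: "map (\<lambda>a. complex_of_real (Re a)) as = as"
    by (intro map_idI) simp
  define bs where "bs = map Re as"
  have asb: "as = map complex_of_real bs" using as_Re by (simp add: bs_def comp_def)
  interpret of_real_poly_hom: map_poly_inj_idom_hom complex_of_real ..
  have "map_poly complex_of_real (char_poly A) = char_poly ?C"
    by (rule of_real_hom.char_poly_hom[OF A, symmetric])
  also have "\<dots> = map_poly complex_of_real (\<Prod>b\<leftarrow>bs. [:- b, 1:])"
    unfolding as(1) asb by (simp add: of_real_poly_hom.hom_prod_list comp_def)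
  finally have "char_poly A = (\<Prod>b\<leftarrow>bs. [:- b, 1:])" by simp
  moreover have "size (proots (\<Prod>b\<leftarrow>bs. [:- b, 1:])) = length bs" for bs :: "real list"
  proof (induction bs)
    case (Cons b bs)
    have "(\<Prod>b\<leftarrow>bs. [:- b, 1:]) \<noteq> 0" by (auto simp: prod_list_zero_iff)
    then have "proots ([:- b, 1:] * (\<Prod>b\<leftarrow>bs. [:- b, 1:]))
             = proots [:- b, 1:] + proots (\<Prod>b\<leftarrow>bs. [:- b, 1:])"
      by (intro proots_mult) auto
    then show ?case using Cons by simp
  qed simp
  ultimately have "size (proots (char_poly A)) = length bs" by simp
  then show ?thesis using as(2) by (simp add: bs_def)
qed

lemma size_sl_spectrum:
  assumes "pair_graph G"
  shows "size (sl_spectrum G) = card (pverts G)"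
proof -
  interpret pair_graph G by fact
  let ?vs = "vertex_list G"
  have vs: "distinct ?vs" "set ?vs = pverts G" using vertex_list[OF pair_finite_verts] by auto
  have "(signless_laplacian ?vs G)\<^sup>T = signless_laplacian ?vs G"
    by (rule eq_matI)
      (auto simp: signless_laplacian_def degree_mat_def adjacency_mat_def intro: arcs_symmetric)
  then have "size (sl_spectrum G) = length ?vs"
    unfolding sl_spectrum_def by (rule real_symmetric_size_proots[OF signless_laplacian_carrier])
  then show ?thesis using vs distinct_card by metis
qed

lemma pair_graph_nns_join:
  assumes "pair_graph G1" "pair_graph G2"
  shows "pair_graph (nns_join G1 G2)"
proof -
  interpret G1: pair_graph G1 by fact
  interpret G2: pair_graph G2 by fact
  let ?H = "nns_join G1 G2"
  have wf: "parcs ?H \<subseteq> pverts ?H \<times> pverts ?H"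
    using G1.in_arcsD1 G1.in_arcsD2 G2.in_arcsD1 G2.in_arcsD2
    by (auto simp: nns_join_def graph_join_def)
  have fin: "finite (pverts ?H)"
    using G1.pair_finite_verts G2.pair_finite_verts by (simp add: nns_join_def graph_join_def)
  have sym: "(y, x) \<in> parcs ?H" if "(x, y) \<in> parcs ?H" for x y
    using that by (auto simp: nns_join_def graph_join_def intro: G1.arcs_symmetric G2.arcs_symmetric)
  have loops: "(x, x) \<notin> parcs ?H" for x
    by (auto simp: nns_join_def graph_join_def dest: G1.no_loops' G2.no_loops')
  show ?thesis
  proof
    show "finite (parcs ?H)" using wf fin by (meson finite_SigmaI finite_subset)
    show "symmetric (with_proj ?H)" using sym by (simp add: symmetric_def sym_def)
  qed (use wf fin loops in auto)
qed

end

theory Submission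
  imports Defs
begin

text \<open>With \<open>Q\<^sub>1\<close>, \<open>Q\<^sub>2\<close> the signless Laplacians of the two graphs and \<open>B = J - (1 - r\<^sub>1) I - Q\<^sub>1\<close> the
  adjacency matrix of the complement of \<open>G\<^sub>1\<close>, the matrix \<open>x I - Q\<close> of the NNS join is a
  \<open>3 \<times> 3\<close> block matrix. A Schur complement eliminates the blocks of \<open>G\<^sub>2\<close> and of the new
  vertices; since both graphs are regular, what remains is a quadratic polynomial in \<open>Q\<^sub>1\<close> plus
  a multiple of \<open>J\<close>. For large real \<open>x\<close> the quadratic splits over the reals, so its
  determinant is a product of two values of the characteristic polynomial of \<open>Q\<^sub>1\<close>, and
  the multiple of \<open>J\<close> is a rank one perturbation along the eigenvector of ones, which only
  alters the factor of the eigenvalue \<open>2 r\<^sub>1\<close>. That eigenvalue is \<open>\<nu>\<^sub>1\<close>, because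
  eigenvalues of a nonnegative matrix are bounded by its constant row sum. Polynomials that agree for
  all large \<open>x\<close> are equal, which identifies the multisets of roots.\<close>

section \<open>Determinants by block elimination and rank one perturbation\<close>

lemma poly_char_poly_eq_det:
  assumes "A \<in> carrier_mat n n"
  shows "poly (char_poly A) x = det (x \<cdot>\<^sub>m 1\<^sub>m n - A)"
  unfolding char_poly_def
  by (rule poly_det_cong[of _ n]) (use assms in \<open>auto simp: char_poly_matrix_def\<close>)

text \<open>An explicit solution \<open>K\<close> of \<open>W + Z * K = 0\<close> replaces the
  inverse of \<open>Z\<close> in the Schur complement: right multiplication by the determinant-one
  matrix \<open>?E\<close> adds the right block column times \<open>K\<close> to the left one, which
  clears the lower left block.\<close>

lemma det_four_block_mat_col_elim:
  fixes X :: "'c :: idom mat"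
  assumes X: "X \<in> carrier_mat n n" and Y: "Y \<in> carrier_mat n m"
    and W: "W \<in> carrier_mat m n" and Z: "Z \<in> carrier_mat m m"
    and K: "K \<in> carrier_mat m n" and 0: "W + Z * K = 0\<^sub>m m n"
  shows "det (four_block_mat X Y W Z) = det (X + Y * K) * det Z"
proof -
  let ?E = "four_block_mat (1\<^sub>m n) (0\<^sub>m n m) K (1\<^sub>m m)"
  have E: "det ?E = 1"
    by (subst det_four_block_mat_upper_right_zero[of _ n _ m]) (use K in auto)
  have "four_block_mat X Y W Z * ?E = four_block_mat (X + Y * K) Y (0\<^sub>m m n) Z"
    by (subst mult_four_block_mat[OF X Y W Z]) (use assms in auto)
  then have "det (four_block_mat X Y W Z) * det ?E = det (four_block_mat (X + Y * K) Y (0\<^sub>m m n) Z)"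
    by (subst det_mult[of _ "n + m", symmetric]) (use assms in auto)
  also have "\<dots> = det (X + Y * K) * det Z"
    by (rule det_four_block_mat_lower_left_zero) (use assms in auto)
  finally show ?thesis unfolding E by simp
qed

text \<open>The mirror image, clearing the upper right block. Together with
  \<open>det_four_block_mat_col_elim\<close> it allows one bordered determinant to be evaluated in
  two ways.\<close>

lemma det_four_block_mat_row_elim:
  fixes X :: "'c :: idom mat"
  assumes X: "X \<in> carrier_mat n n" and Y: "Y \<in> carrier_mat n m"
    and W: "W \<in> carrier_mat m n" and Z: "Z \<in> carrier_mat m m"
    and L: "L \<in> carrier_mat n m" and 0: "X * L + Y = 0\<^sub>m n m"
  shows "det (four_block_mat X Y W Z) = det X * det (W * L + Z)"
proof -
  let ?E = "four_block_mat (1\<^sub>m n) L (0\<^sub>m m n) (1\<^sub>m m)"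
  have E: "det ?E = 1"
    by (subst det_four_block_mat_lower_left_zero[of _ n _ m]) (use L in auto)
  have "four_block_mat X Y W Z * ?E = four_block_mat X (0\<^sub>m n m) W (W * L + Z)"
    by (subst mult_four_block_mat[OF X Y W Z]) (use assms in auto)
  then have "det (four_block_mat X Y W Z) * det ?E = det (four_block_mat X (0\<^sub>m n m) W (W * L + Z))"
    by (subst det_mult[of _ "n + m", symmetric]) (use assms in auto)
  also have "\<dots> = det X * det (W * L + Z)"
    by (rule det_four_block_mat_upper_right_zero) (use assms in auto)
  finally show ?thesis unfolding E by simp
qed

text \<open>Rectangular, so that a single column gives the all-ones vector and eigenvector equations
  can be written as matrix products.\<close>

definition ones_mat :: "nat \<Rightarrow> nat \<Rightarrow> 'c :: one mat" where
  "ones_mat m n = mat m n (\<lambda>_. 1)"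

lemma ones_mat_simps [simp]:
  "ones_mat m n \<in> carrier_mat m n" "dim_row (ones_mat m n) = m" "dim_col (ones_mat m n) = n"
  "i < m \<Longrightarrow> j < n \<Longrightarrow> ones_mat m n $$ (i, j) = 1"
  by (auto simp: ones_mat_def)

lemma ones_mat_mult: "ones_mat a b * ones_mat b c = (of_nat b \<cdot>\<^sub>m ones_mat a c :: 'c :: semiring_1 mat)"
  by (rule eq_matI) (auto simp: scalar_prod_def)

lemma mult_ones_mat:
  assumes "A \<in> carrier_mat m n" "\<And>i. i < m \<Longrightarrow> (\<Sum>j<n. A $$ (i, j)) = (s :: 'c :: semiring_1)"
  shows "A * ones_mat n k = s \<cdot>\<^sub>m ones_mat m k"
  by (rule eq_matI) (use assms in \<open>auto simp: scalar_prod_def atLeast0LessThan\<close>)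

lemma ones_mat_mult_left:
  assumes "A \<in> carrier_mat m n" "\<And>j. j < n \<Longrightarrow> (\<Sum>i<m. A $$ (i, j)) = (s :: 'c :: semiring_1)"
  shows "ones_mat k m * A = s \<cdot>\<^sub>m ones_mat k n"
  by (rule eq_matI) (use assms in \<open>auto simp: scalar_prod_def atLeast0LessThan\<close>)

text \<open>Both sides are the determinant of \<open>M\<close> bordered by a column \<open>k\<close> and a row of ones.\<close>

lemma det_minus_smult_ones_mat:
  fixes M :: "'c :: field mat"
  assumes M: "M \<in> carrier_mat n n" and row: "M * ones_mat n 1 = m \<cdot>\<^sub>m ones_mat n 1" and m: "m \<noteq> 0"
  shows "det (M - k \<cdot>\<^sub>m ones_mat n n) = det M * (1 - k / m * of_nat n)"
proof -
  let ?B = "four_block_mat M (k \<cdot>\<^sub>m ones_mat n 1) (ones_mat 1 n) (1\<^sub>m 1)"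
  have "det ?B = det (M + (k \<cdot>\<^sub>m ones_mat n 1) * ((-1) \<cdot>\<^sub>m ones_mat 1 n)) * det (1\<^sub>m 1 :: 'c mat)"
    by (rule det_four_block_mat_col_elim[OF M]) (auto intro!: eq_matI)
  also have "M + (k \<cdot>\<^sub>m ones_mat n 1) * ((-1) \<cdot>\<^sub>m ones_mat 1 n) = M - k \<cdot>\<^sub>m ones_mat n n"
    by (rule eq_matI) (use M in \<open>auto simp: scalar_prod_def\<close>)
  finally have 1: "det ?B = det (M - k \<cdot>\<^sub>m ones_mat n n)" by simp
  \<comment> \<open>By \<open>row\<close> the ones vector is an eigenvector of \<open>M\<close> for
    \<open>m\<close>, so this multiple of it is sent to \<open>- k\<close> times the ones vector and
    cancels the border column.\<close>
  let ?L = "(- k / m) \<cdot>\<^sub>m ones_mat n 1 :: 'c mat"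
  have "M * ?L = (- k / m) \<cdot>\<^sub>m (M * ones_mat n 1)"
    by (rule mult_smult_distrib[OF M ones_mat_simps(1)])
  then have "M * ?L + k \<cdot>\<^sub>m ones_mat n 1 = 0\<^sub>m n 1"
    unfolding row using m by (intro eq_matI) auto
  then have "det ?B = det M * det (ones_mat 1 n * ?L + 1\<^sub>m 1)"
    by (intro det_four_block_mat_row_elim[OF M]) auto
  also have "ones_mat 1 n * ?L + 1\<^sub>m 1 = (1 - k / m * of_nat n) \<cdot>\<^sub>m 1\<^sub>m 1"
    by (rule eq_matI) (auto simp: scalar_prod_def)
  finally show ?thesis using 1 by simp
qed

section \<open>Quadratics in a matrix and the Schur complement of the join\<close>

lemma minus_mult_minus_mat:
  fixes A B C D :: "'c :: ring mat"
  assumes "A \<in> carrier_mat m n" "B \<in> carrier_mat m n" "C \<in> carrier_mat n k" "D \<in> carrier_mat n k"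
  shows "(A - B) * (C - D) = A * C - A * D - (B * C - B * D)"
proof -
  have "(A - B) * (C - D) = A * (C - D) - B * (C - D)"
    by (rule minus_mult_distrib_mat) (use assms in auto)
  also have "A * (C - D) = A * C - A * D"
    by (rule mult_minus_distrib_mat) (use assms in auto)
  also have "B * (C - D) = B * C - B * D"
    by (rule mult_minus_distrib_mat) (use assms in auto)
  finally show ?thesis .
qed

text \<open>The matrix quadratic is \<open>- (s I - M) (t I - M)\<close>, so up to the sign
  \<open>(-1) ^ n\<close> its determinant is the product of the characteristic polynomial's values
  at \<open>s\<close> and \<open>t\<close>. As \<open>card I = n\<close>, the sign distributes over
  the eigenvalue factors.\<close>

lemma det_quadratic_mat:
  fixes M :: "'c :: field mat"
  assumes M: "M \<in> carrier_mat n n"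
    and split: "\<And>x. poly (char_poly M) x = (\<Prod>i\<in>I. x - l i)" and I: "card I = n"
  shows "det ((- (s * t)) \<cdot>\<^sub>m 1\<^sub>m n + (s + t) \<cdot>\<^sub>m M - M * M) = (\<Prod>i\<in>I. - (s * t) + (s + t) * l i - l i * l i)"
proof -
  let ?S = "s \<cdot>\<^sub>m 1\<^sub>m n - M" and ?T = "t \<cdot>\<^sub>m 1\<^sub>m n - M"
  have ST: "?S \<in> carrier_mat n n" "?T \<in> carrier_mat n n" using M by auto
  have "?S * ?T = (s \<cdot>\<^sub>m 1\<^sub>m n) * (t \<cdot>\<^sub>m 1\<^sub>m n) - (s \<cdot>\<^sub>m 1\<^sub>m n) * M - (M * (t \<cdot>\<^sub>m 1\<^sub>m n) - M * M)"
    by (rule minus_mult_minus_mat) (use M in auto)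
  also have "\<dots> = (s * t) \<cdot>\<^sub>m 1\<^sub>m n - s \<cdot>\<^sub>m M - (t \<cdot>\<^sub>m M - M * M)"
    using M by (simp add: mult_smult_distrib[of _ n n] mult_smult_assoc_mat[of _ n n])
       (auto intro!: eq_matI)
  finally have "(- (s * t)) \<cdot>\<^sub>m 1\<^sub>m n + (s + t) \<cdot>\<^sub>m M - M * M = (-1) \<cdot>\<^sub>m (?S * ?T)"
    using M by (auto intro!: eq_matI simp: algebra_simps)
  then have "det ((- (s * t)) \<cdot>\<^sub>m 1\<^sub>m n + (s + t) \<cdot>\<^sub>m M - M * M) = (-1) ^ n * (det ?S * det ?T)"
    using M by (simp add: det_mult[OF ST])
  also have "\<dots> = (-1) ^ n * ((\<Prod>i\<in>I. s - l i) * (\<Prod>i\<in>I. t - l i))"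
    using poly_char_poly_eq_det[OF M] split by metis
  also have "\<dots> = (\<Prod>i\<in>I. - ((s - l i) * (t - l i)))"
    using I by (simp only: prod_uminus prod.distrib)
  finally show ?thesis by (simp add: algebra_simps)
qed

text \<open>Schur complement of the block diagonal part formed by \<open>Z\<close> and
  \<open>e I\<close>. Regularity of the second graph enters through \<open>rows\<close>: inverting
  \<open>Z\<close> on an all-ones block is just division by \<open>y\<close>. Blocks with zero rows
  or columns express the block row \<open>[J, B]\<close> and the block column \<open>[J; B]\<close>
  through \<open>four_block_mat\<close>.\<close>

lemma det_nns_block:
  fixes X :: "'c :: field mat"
  assumes X: "X \<in> carrier_mat n n" and B: "B \<in> carrier_mat n n" and Z: "Z \<in> carrier_mat m m"
    and rows: "Z * ones_mat m n = y \<cdot>\<^sub>m ones_mat m n" and y: "y \<noteq> 0" and e: "e \<noteq> 0"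
  shows "det (four_block_mat X
      (- four_block_mat (ones_mat n m) B (0\<^sub>m 0 m) (0\<^sub>m 0 n))
      (- four_block_mat (ones_mat m n) (0\<^sub>m m 0) B (0\<^sub>m n 0))
      (four_block_mat Z (0\<^sub>m m n) (0\<^sub>m n m) (e \<cdot>\<^sub>m 1\<^sub>m n)))
    = e ^ n * det Z * det (X - (of_nat m / y) \<cdot>\<^sub>m ones_mat n n - (1 / e) \<cdot>\<^sub>m (B * B))"
proof -
  let ?Y = "four_block_mat (ones_mat n m) B (0\<^sub>m 0 m) (0\<^sub>m 0 n)"
  let ?W = "four_block_mat (ones_mat m n) (0\<^sub>m m 0) B (0\<^sub>m n 0)"
  let ?D = "four_block_mat Z (0\<^sub>m m n) (0\<^sub>m n m) (e \<cdot>\<^sub>m 1\<^sub>m n)"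
  \<comment> \<open>This is the inverse of \<open>?D\<close> applied to \<open>?W\<close>:
    \<open>rows\<close> gives the factor \<open>1 / y\<close>, and the scalar block gives
    \<open>1 / e\<close>.\<close>
  let ?K = "four_block_mat ((1 / y) \<cdot>\<^sub>m ones_mat m n) (0\<^sub>m m 0) ((1 / e) \<cdot>\<^sub>m B) (0\<^sub>m n 0)"
  have carr: "?Y \<in> carrier_mat n (m + n)" "?W \<in> carrier_mat (m + n) n"
    "?D \<in> carrier_mat (m + n) (m + n)" "?K \<in> carrier_mat (m + n) n"
    using four_block_carrier_mat[of "ones_mat n m" n m "0\<^sub>m 0 n" 0 n B "0\<^sub>m 0 m"]
      four_block_carrier_mat[of "ones_mat m n" m n "0\<^sub>m n 0" n 0 "0\<^sub>m m 0" B]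
      four_block_carrier_mat[of "(1 / y) \<cdot>\<^sub>m ones_mat m n" m n "0\<^sub>m n 0" n 0 "0\<^sub>m m 0" "(1 / e) \<cdot>\<^sub>m B"]
      four_block_carrier_mat[of Z m m "e \<cdot>\<^sub>m 1\<^sub>m n" n n] Z B by auto
  have "?D * ?K = four_block_mat (Z * ((1 / y) \<cdot>\<^sub>m ones_mat m n)) (0\<^sub>m m 0) B (0\<^sub>m n 0)"
    using Z B e
    by (subst mult_four_block_mat[of _ m m _ n _ n _ _ n _ 0])
      (auto simp: mult_smult_distrib[of _ n n] intro!: arg_cong2[where f = "\<lambda>a b. four_block_mat a _ b _"] eq_matI)
  also have "Z * ((1 / y) \<cdot>\<^sub>m ones_mat m n) = ones_mat m n"
    using y by (subst mult_smult_distrib[OF Z ones_mat_simps(1)], unfold rows) (auto intro!: eq_matI)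
  finally have "- ?W + ?D * ?K = 0\<^sub>m (m + n) n"
    using carr by auto
  then have "det (four_block_mat X (- ?Y) (- ?W) ?D) = det (X + - ?Y * ?K) * det ?D"
    by (intro det_four_block_mat_col_elim[OF X]) (use carr in auto)
  also have "det ?D = det Z * e ^ n"
    by (subst det_four_block_mat_upper_right_zero[OF Z]) auto
  also have "?Y * ?K = four_block_mat ((1 / y) \<cdot>\<^sub>m (of_nat m \<cdot>\<^sub>m ones_mat n n) + (1 / e) \<cdot>\<^sub>m (B * B)) (0\<^sub>m n 0) (0\<^sub>m 0 n) (0\<^sub>m 0 0)"
    using B
    by (subst mult_four_block_mat[of _ n m _ n _ 0 _ _ n _ 0])
      (auto simp: ones_mat_mult mult_smult_distrib[of _ n n]
        mult_smult_distrib[OF ones_mat_simps(1) ones_mat_simps(1)])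
  then have "- ?Y * ?K = - ((1 / y) \<cdot>\<^sub>m (of_nat m \<cdot>\<^sub>m ones_mat n n) + (1 / e) \<cdot>\<^sub>m (B * B))"
    using carr B by (auto intro!: eq_matI)
  then have "X + - ?Y * ?K = X - (of_nat m / y) \<cdot>\<^sub>m ones_mat n n - (1 / e) \<cdot>\<^sub>m (B * B)"
    using X B by (auto intro!: eq_matI simp: field_simps)
  finally show ?thesis by (simp add: mult_ac)
qed

text \<open>Meant for the adjacency matrix of the complement. Constant row and column sums turn
  every mixed product with \<open>J\<close> into a multiple of \<open>J\<close>, and
  \<open>J * J = n J\<close>, so the expansion leaves a single \<open>J\<close> term.\<close>

lemma square_ones_minus:
  fixes M :: "'c :: comm_ring_1 mat"
  assumes M: "M \<in> carrier_mat n n"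
    and rows: "M * ones_mat n n = s \<cdot>\<^sub>m ones_mat n n" and cols: "ones_mat n n * M = s \<cdot>\<^sub>m ones_mat n n"
  shows "(ones_mat n n - (b \<cdot>\<^sub>m 1\<^sub>m n + M)) * (ones_mat n n - (b \<cdot>\<^sub>m 1\<^sub>m n + M))
    = (of_nat n - 2 * b - 2 * s) \<cdot>\<^sub>m ones_mat n n + b\<^sup>2 \<cdot>\<^sub>m 1\<^sub>m n + (2 * b) \<cdot>\<^sub>m M + M * M"
proof -
  let ?J = "ones_mat n n :: 'c mat" and ?C = "b \<cdot>\<^sub>m 1\<^sub>m n + M"
  have C: "?C \<in> carrier_mat n n" using M by auto
  have 1: "?J * ?C = b \<cdot>\<^sub>m ?J + s \<cdot>\<^sub>m ?J"
    using M by (subst mult_add_distrib_mat[of _ n n _ n]) (auto simp: cols mult_smult_distrib[of _ n n])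
  have 2: "?C * ?J = b \<cdot>\<^sub>m ?J + s \<cdot>\<^sub>m ?J"
    using M by (subst add_mult_distrib_mat[of _ n n _ _ n]) (auto simp: rows mult_smult_assoc_mat[of _ n n])
  have "?C * ?C = (b \<cdot>\<^sub>m 1\<^sub>m n) * ?C + M * ?C"
    using M by (subst add_mult_distrib_mat[of _ n n _ _ n]) auto
  also have "M * ?C = b \<cdot>\<^sub>m M + M * M"
    using M by (subst mult_add_distrib_mat[of _ n n _ n]) (auto simp: mult_smult_distrib[of _ n n])
  also have "(b \<cdot>\<^sub>m 1\<^sub>m n) * ?C = b \<cdot>\<^sub>m ?C"
    by (subst mult_smult_assoc_mat[of _ n n _ n]) (use M in auto)
  finally have 3: "?C * ?C = b \<cdot>\<^sub>m ?C + (b \<cdot>\<^sub>m M + M * M)" .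
  have "(?J - ?C) * (?J - ?C) = ?J * ?J - ?J * ?C - (?C * ?J - ?C * ?C)"
    by (rule minus_mult_minus_mat) (use C in auto)
  also have "\<dots> = (of_nat n - 2 * b - 2 * s) \<cdot>\<^sub>m ?J + b\<^sup>2 \<cdot>\<^sub>m 1\<^sub>m n + (2 * b) \<cdot>\<^sub>m M + M * M"
    unfolding 1 2 3 ones_mat_mult using M
    by (intro eq_matI) (auto simp: algebra_simps power2_eq_square)
  finally show ?thesis .
qed

text \<open>\<open>s\<close> and \<open>t\<close> are the roots of \<open>X^2 - p X - q\<close>,
  whose discriminant is the quantity assumed nonnegative.\<close>

lemma real_quadratic_factors:
  fixes p q :: real
  assumes "p\<^sup>2 + 4 * q \<ge> 0"
  obtains s t where "s + t = p" "- (s * t) = q"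
proof
  let ?w = "sqrt (p\<^sup>2 + 4 * q)"
  show "(p + ?w) / 2 + (p - ?w) / 2 = p" by (simp add: field_simps)
  have "?w * ?w = p\<^sup>2 + 4 * q" using assms by simp
  then show "- ((p + ?w) / 2 * ((p - ?w) / 2)) = q"
    by (simp add: field_simps power2_eq_square)
qed

text \<open>Scaling the Schur complement by \<open>e\<close> clears \<open>1 / e\<close> and leaves
  a quadratic in \<open>M\<close> minus a multiple of \<open>J\<close>; \<open>q v\<close> is the
  value of that quadratic at an eigenvalue \<open>v\<close> of \<open>M\<close>. Its discriminant is
  \<open>e\<close> times the quantity in \<open>disc\<close>, so it splits over the reals. The
  \<open>J\<close> term is then absorbed by \<open>det_minus_smult_ones_mat\<close> at the
  eigenvalue \<open>q s\<close> of the ones vector; multiplying through by \<open>q s\<close>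
  removes the division.\<close>

lemma det_nns_schur_complement:
  fixes M :: "real mat" and l :: "'i \<Rightarrow> real" and n :: nat and a b e k s :: real
  assumes M: "M \<in> carrier_mat n n"
    and row: "\<And>i. i < n \<Longrightarrow> (\<Sum>j<n. M $$ (i, j)) = s" and col: "\<And>j. j < n \<Longrightarrow> (\<Sum>i<n. M $$ (i, j)) = s"
    and split: "\<And>x. poly (char_poly M) x = (\<Prod>i\<in>I. x - l i)" and I: "card I = n"
    and e: "e > 0" and disc: "e + 4 * b + 4 * a \<ge> 0"
    and q: "\<And>v. q v = (a - v) * e - (b + v)\<^sup>2" and qs: "q s \<noteq> 0"
  shows "e ^ n * det (a \<cdot>\<^sub>m 1\<^sub>m n - M - k \<cdot>\<^sub>m ones_mat n n
        - (1 / e) \<cdot>\<^sub>m ((ones_mat n n - (b \<cdot>\<^sub>m 1\<^sub>m n + M)) * (ones_mat n n - (b \<cdot>\<^sub>m 1\<^sub>m n + M)))) * q s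
    = (\<Prod>i\<in>I. q (l i)) * (q s - (k * e + (n - 2 * b - 2 * s)) * n)"
proof -
  let ?J = "ones_mat n n :: real mat"
  have rows: "M * ones_mat n m = s \<cdot>\<^sub>m ones_mat n m" for m by (rule mult_ones_mat[OF M row])
  have cols: "?J * M = s \<cdot>\<^sub>m ?J" by (rule ones_mat_mult_left[OF M col])
  have "(- e - 2 * b)\<^sup>2 + 4 * (a * e - b\<^sup>2) = e * (e + 4 * b + 4 * a)"
    by (simp add: algebra_simps power2_eq_square)
  also have "\<dots> \<ge> 0" using e disc by simp
  finally obtain u t where ut: "u + t = - e - 2 * b" "- (u * t) = a * e - b\<^sup>2"
    by (rule real_quadratic_factors)
  let ?F = "(- (u * t)) \<cdot>\<^sub>m 1\<^sub>m n + (u + t) \<cdot>\<^sub>m M - M * M"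
  have F: "?F \<in> carrier_mat n n" using M by auto
  have detF: "det ?F = (\<Prod>i\<in>I. q (l i))"
    unfolding det_quadratic_mat[OF M split I] unfolding ut q
    by (simp add: algebra_simps power2_eq_square)
  have "M * M * ones_mat n 1 = M * (M * ones_mat n 1)"
    by (rule assoc_mult_mat[OF M M ones_mat_simps(1)])
  then have MM: "M * M * ones_mat n 1 = s \<cdot>\<^sub>m (s \<cdot>\<^sub>m ones_mat n 1)"
    unfolding rows mult_smult_distrib[OF M ones_mat_simps(1)] .
  have "?F * ones_mat n 1 = ((- (u * t)) \<cdot>\<^sub>m 1\<^sub>m n + (u + t) \<cdot>\<^sub>m M) * ones_mat n 1 - M * M * ones_mat n 1"
    by (rule minus_mult_distrib_mat[of _ n n]) (use M in auto)
  also have "((- (u * t)) \<cdot>\<^sub>m 1\<^sub>m n + (u + t) \<cdot>\<^sub>m M) * ones_mat n 1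
      = (- (u * t)) \<cdot>\<^sub>m 1\<^sub>m n * ones_mat n 1 + (u + t) \<cdot>\<^sub>m M * ones_mat n 1"
    by (rule add_mult_distrib_mat[of _ n n]) (use M in auto)
  also have "\<dots> - M * M * ones_mat n 1 = q s \<cdot>\<^sub>m ones_mat n 1"
    unfolding MM mult_smult_assoc_mat[OF M ones_mat_simps(1)]
      mult_smult_assoc_mat[OF one_carrier_mat ones_mat_simps(1)] rows
    unfolding ut q
    by (intro eq_matI) (auto simp: algebra_simps power2_eq_square)
  finally have Frow: "?F * ones_mat n 1 = q s \<cdot>\<^sub>m ones_mat n 1" .
  \<comment> \<open>The coefficient of \<open>J\<close> after scaling: \<open>k * e\<close> from the
    perturbation already present, the rest from the square of the complement's matrix.\<close>
  let ?k = "k * e + (n - 2 * b - 2 * s)"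
  let ?G = "a \<cdot>\<^sub>m 1\<^sub>m n - M - k \<cdot>\<^sub>m ?J
        - (1 / e) \<cdot>\<^sub>m ((?J - (b \<cdot>\<^sub>m 1\<^sub>m n + M)) * (?J - (b \<cdot>\<^sub>m 1\<^sub>m n + M)))"
  have G: "e \<cdot>\<^sub>m ?G = ?F - ?k \<cdot>\<^sub>m ?J"
    unfolding square_ones_minus[OF M rows cols] ut using M e
    by (intro eq_matI) (auto simp: field_simps power2_eq_square)
  have "dim_col ?G = n" using M by simp
  then have "e ^ n * det ?G = det (e \<cdot>\<^sub>m ?G)" by simp
  also have "\<dots> = det ?F * (1 - ?k / q s * n)"
    unfolding G by (rule det_minus_smult_ones_mat[OF F Frow qs])
  finally show ?thesis using qs detF by (simp add: field_simps)
qed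

section \<open>Split polynomials, sorted spectra and the largest eigenvalue\<close>

lemma poly_split_proots:
  fixes p :: "'c :: idom poly"
  assumes "p \<noteq> 0" "size (proots p) = degree p"
  shows "p = Polynomial.smult (lead_coeff p) (\<Prod>a\<in>#proots p. [:- a, 1:])"
  using assms
proof (induction "degree p" arbitrary: p)
  case 0
  then obtain c where "p = [:c:]" by (metis degree_eq_zeroE)
  with 0 show ?case by simp
next
  case (Suc n)
  then have "proots p \<noteq> {#}" by auto
  then obtain a where "a \<in># proots p" by blast
  then have "poly p a = 0" using Suc.prems(1) by simp
  then obtain q where q: "p = [:- a, 1:] * q" by (auto simp: poly_eq_0_iff_dvd)
  have "q \<noteq> 0" using q Suc.prems by auto
  then have rp: "proots p = {#a#} + proots q" unfolding q by (subst proots_mult) auto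
  have dp: "degree p = Suc (degree q)" using \<open>q \<noteq> 0\<close> unfolding q by (subst degree_mult_eq) auto
  \<comment> \<open>Dividing out one linear factor removes one root and lowers the degree by one, so
    \<open>q\<close> inherits the hypothesis that all roots are present.\<close>
  have "q = Polynomial.smult (lead_coeff q) (\<Prod>a\<in>#proots q. [:- a, 1:])"
    by (rule Suc.hyps(1)) (use Suc dp rp \<open>q \<noteq> 0\<close> in auto)
  moreover have "lead_coeff p = lead_coeff q" unfolding q lead_coeff_mult by simp
  ultimately have "Polynomial.smult (lead_coeff p) (\<Prod>a\<in>#proots p. [:- a, 1:]) = [:- a, 1:] * q"
    unfolding rp by (simp only: image_mset_union prod_mset.union image_mset_single prod_mset.singleton
        mult_smult_right[symmetric])
  then show ?case using q by simp
qed

text \<open>Compare both sides of the eigenvector equation at a coordinate of largest absolute value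
  \<open>m\<close>; nonnegative entries bound the right side by \<open>s * m\<close>.\<close>

lemma eigenvalue_le_row_sum:
  fixes A :: "real mat"
  assumes A: "A \<in> carrier_mat n n" and nn: "\<And>i j. i < n \<Longrightarrow> j < n \<Longrightarrow> 0 \<le> A $$ (i, j)"
    and row: "\<And>i. i < n \<Longrightarrow> (\<Sum>j<n. A $$ (i, j)) = s" and k: "eigenvalue A k"
  shows "k \<le> s"
proof -
  obtain v where v: "v \<in> carrier_vec n" "v \<noteq> 0\<^sub>v n" "A *\<^sub>v v = k \<cdot>\<^sub>v v"
    using k A unfolding eigenvalue_def eigenvector_def by auto
  obtain l where l: "l < n" "v $ l \<noteq> 0" using v(1,2) by (metis carrier_vecD eq_vecI index_zero_vec)
  define m where "m = Max ((\<lambda>i. \<bar>v $ i\<bar>) ` {..<n})"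
  have m: "\<bar>v $ i\<bar> \<le> m" if "i < n" for i unfolding m_def using that by (intro Max_ge) auto
  have "m \<in> (\<lambda>i. \<bar>v $ i\<bar>) ` {..<n}" unfolding m_def using l by (intro Max_in) auto
  then obtain i where i: "i < n" "\<bar>v $ i\<bar> = m" by auto
  have "k * v $ i = (A *\<^sub>v v) $ i" using v i by simp
  also have "\<dots> = (\<Sum>j<n. A $$ (i, j) * v $ j)"
    using A v(1) i by (simp add: scalar_prod_def atLeast0LessThan)
  finally have "\<bar>k\<bar> * m \<le> (\<Sum>j<n. \<bar>A $$ (i, j) * v $ j\<bar>)"
    unfolding i(2)[symmetric] by (metis abs_mult sum_abs)
  also have "\<dots> \<le> (\<Sum>j<n. A $$ (i, j) * m)"
    using m nn i by (intro sum_mono) (auto simp: abs_mult intro!: mult_left_mono)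
  also have "\<dots> = s * m" using row[OF i(1)] by (simp flip: sum_distrib_right)
  finally have "\<bar>k\<bar> * m \<le> s * m" .
  moreover have "m > 0" using m[OF l(1)] l(2) by linarith
  ultimately show ?thesis by simp
qed

lemma eigenvalue_row_sum:
  fixes A :: "real mat"
  assumes A: "A \<in> carrier_mat n n" and row: "\<And>i. i < n \<Longrightarrow> (\<Sum>j<n. A $$ (i, j)) = s" and "n > 0"
  shows "eigenvalue A s"
proof -
  let ?v = "vec n (\<lambda>_. 1) :: real vec"
  have "?v $ 0 \<noteq> 0\<^sub>v n $ 0" using assms by simp
  then have "?v \<noteq> 0\<^sub>v n" by (rule contrapos_nn) (rule arg_cong)
  moreover have "A *\<^sub>v ?v = s \<cdot>\<^sub>v ?v"
    using A row by (intro eq_vecI) (auto simp: scalar_prod_def atLeast0LessThan)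
  ultimately show ?thesis using A unfolding eigenvalue_def eigenvector_def
    by (intro exI[of _ ?v]) auto
qed

lemma sl_spectrum_eq_sl_eigenvalues:
  assumes "size (sl_spectrum G) = n"
  shows "sl_spectrum G = image_mset (\<nu> G) (mset_set {1..n})"
proof -
  let ?xs = "rev (sorted_list_of_multiset (sl_spectrum G))"
  have len: "length ?xs = n" using assms by (metis length_rev mset_sorted_list_of_multiset size_mset)
  have "image_mset (\<nu> G) (mset_set {1..n}) = mset (map (\<nu> G) [1..<Suc n])"
    unfolding mset_map mset_upt atLeastLessThanSuc_atLeastAtMost ..
  \<comment> \<open>List positions start at 0 while \<open>\<nu> G\<close> starts at 1, hence the
    range \<open>[1..<Suc n]\<close>.\<close>
  also have "map (\<nu> G) [1..<Suc n] = ?xs"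
    by (rule nth_equalityI) (use len in \<open>auto simp: sl_eigenvalue_def simp del: upt_Suc\<close>)
  finally show ?thesis by simp
qed

lemma sl_eigenvalue_1:
  assumes "a \<in># sl_spectrum G" "\<And>b. b \<in># sl_spectrum G \<Longrightarrow> b \<le> a"
  shows "\<nu> G 1 = a"
proof -
  let ?xs = "sorted_list_of_multiset (sl_spectrum G)"
  have set: "set ?xs = set_mset (sl_spectrum G)" by simp
  have ne: "?xs \<noteq> []" using assms(1) set by (metis empty_iff empty_set)
  obtain i where i: "i < length ?xs" "?xs ! i = a" using assms(1) set by (metis in_set_conv_nth)
  have "?xs ! i \<le> ?xs ! (length ?xs - 1)"
    by (rule sorted_nth_mono) (use i in auto)
  then have "a \<le> last ?xs" using i ne by (simp add: last_conv_nth)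
  moreover have "last ?xs \<le> a" using assms(2) ne set last_in_set by metis
  ultimately show ?thesis using ne by (simp add: sl_eigenvalue_def flip: hd_conv_nth) (simp add: hd_rev)
qed

section \<open>The signless Laplacian of a regular graph\<close>

lemma out_degree_with_proj: "out_degree (with_proj G) v = card {w. (v, w) \<in> parcs G}"
proof -
  have "out_arcs (with_proj G) v = Pair v ` {w. (v, w) \<in> parcs G}" by auto
  then show ?thesis unfolding out_degree_def by (simp add: card_image inj_on_def)
qed

context
  fixes G :: "'a pair_pre_digraph" and r n :: nat and vs
  assumes G: "pair_graph G" and reg: "regular_graph r G" and n: "card (pverts G) = n" "n \<ge> 1"
    and vs: "distinct vs" "set vs = pverts G"
begin

interpretation pair_graph G by (rule G)

private lemma length_vs: "length vs = n"
  using vs n by (metis distinct_card)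

private lemma carrier_Q: "signless_laplacian vs G \<in> carrier_mat n n"
  using signless_laplacian_carrier[of vs G] length_vs by simp

private lemma symmetric_Q: "i < n \<Longrightarrow> j < n \<Longrightarrow> signless_laplacian vs G $$ (i, j) = signless_laplacian vs G $$ (j, i)"
  using length_vs by (auto simp: signless_laplacian_def degree_mat_def adjacency_mat_def intro: arcs_symmetric)

text \<open>The diagonal degree contributes \<open>r\<close>, and the neighbours contribute another
  \<open>r\<close>.\<close>

lemma signless_laplacian_row_sum:
  assumes i: "i < n"
  shows "(\<Sum>j<n. signless_laplacian vs G $$ (i, j)) = 2 * real r"
proof -
  have vi: "vs ! i \<in> pverts G" using i vs length_vs nth_mem by blast
  have "(\<Sum>j<n. signless_laplacian vs G $$ (i, j))
      = (\<Sum>j<n. if i = j then real r else 0) + (\<Sum>j<n. if (vs ! i, vs ! j) \<in> parcs G then 1 else 0)"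
    unfolding sum.distrib[symmetric]
    by (rule sum.cong) (use i length_vs vi reg in
      \<open>auto simp: signless_laplacian_def degree_mat_def adjacency_mat_def regular_graph_def\<close>)
  also have "(\<Sum>j<n. if (vs ! i, vs ! j) \<in> parcs G then 1 else 0)
      = (\<Sum>w\<in>pverts G. if (vs ! i, w) \<in> parcs G then 1 else 0 :: real)"
    by (rule sum.reindex_bij_betw, rule bij_betw_nth) (use vs length_vs in auto)
  also have "\<dots> = real (card {w \<in> pverts G. (vs ! i, w) \<in> parcs G})"
    by (simp add: sum.If_cases Int_def)
  also have "{w \<in> pverts G. (vs ! i, w) \<in> parcs G} = {w. (vs ! i, w) \<in> parcs G}"
    using in_arcsD2 by auto
  also have "card \<dots> = r" using reg vi by (simp add: regular_graph_def out_degree_with_proj)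
  finally show ?thesis using i by simp
qed

lemma signless_laplacian_col_sum:
  assumes "j < n"
  shows "(\<Sum>i<n. signless_laplacian vs G $$ (i, j)) = 2 * real r"
  using signless_laplacian_row_sum[OF assms] symmetric_Q[OF assms] by simp

text \<open>Fixes which index is treated separately in the final spectrum: the eigenvalue of the
  ones vector is the constant row sum, which is also an upper bound for all eigenvalues, so it sits
  at index 1.\<close>

lemma sl_eigenvalue_1_regular: "\<nu> G 1 = 2 * real r"
proof (rule sl_eigenvalue_1)
  note spec = sl_spectrum_eq[OF vs, symmetric]
  have nz: "char_poly (signless_laplacian vs G) \<noteq> 0"
    using degree_monic_char_poly[OF carrier_Q] by auto
  have ev: "k \<in># sl_spectrum G \<longleftrightarrow> eigenvalue (signless_laplacian vs G) k" for k
    unfolding spec eigenvalue_root_char_poly[OF carrier_Q] using nz by simp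
  show "2 * real r \<in># sl_spectrum G"
    unfolding ev by (rule eigenvalue_row_sum[OF carrier_Q signless_laplacian_row_sum]) (use n in auto)
  have nn: "0 \<le> signless_laplacian vs G $$ (i, j)" if "i < n" "j < n" for i j
    using that length_vs by (simp add: signless_laplacian_def degree_mat_def adjacency_mat_def)
  show "k \<le> 2 * real r" if "k \<in># sl_spectrum G" for k
    using eigenvalue_le_row_sum[OF carrier_Q nn signless_laplacian_row_sum] that ev by blast
qed

text \<open>Symmetry provides \<open>n\<close> real roots with multiplicity
  (\<open>size_sl_spectrum\<close>), so the monic characteristic polynomial splits over the
  reals.\<close>

lemma poly_char_poly_signless_laplacian:
  "poly (char_poly (signless_laplacian vs G)) x = (\<Prod>i\<in>{1..n}. x - \<nu> G i)"
proof -
  let ?p = "char_poly (signless_laplacian vs G)"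
  have p: "degree ?p = n" "lead_coeff ?p = 1" using degree_monic_char_poly[OF carrier_Q] by auto
  have size: "size (sl_spectrum G) = n" using size_sl_spectrum[OF G] n by simp
  have spec: "proots ?p = image_mset (\<nu> G) (mset_set {1..n})"
    using sl_spectrum_eq[OF vs] sl_spectrum_eq_sl_eigenvalues[OF size] by simp
  have "?p = Polynomial.smult (lead_coeff ?p) (\<Prod>a\<in>#proots ?p. [:- a, 1:])"
    by (rule poly_split_proots) (use p size spec in auto)
  also have "\<dots> = (\<Prod>i\<in>{1..n}. [:- \<nu> G i, 1:])"
    unfolding p(2) spec by (simp add: prod_unfold_prod_mset image_mset.compositionality comp_def)
  finally have "?p = (\<Prod>i\<in>{1..n}. [:- \<nu> G i, 1:])" .
  then show ?thesis by (simp add: poly_prod)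
qed

end

section \<open>Degrees and block form of the NNS join\<close>

context
  fixes G1 :: "'a pair_pre_digraph" and G2 :: "'b pair_pre_digraph" and r1 r2 n1 n2 :: nat
  assumes G1: "pair_graph G1" and G2: "pair_graph G2"
    and reg1: "regular_graph r1 G1" and reg2: "regular_graph r2 G2"
    and n1: "card (pverts G1) = n1" and n2: "card (pverts G2) = n2"
begin

interpretation G1: pair_graph G1 by (rule G1)
interpretation G2: pair_graph G2 by (rule G2)

text \<open>The neighbours of \<open>u\<close> inside \<open>G1\<close> and the new vertices
  attached to \<open>u\<close> together account for each other vertex of \<open>G1\<close> exactly
  once, so \<open>r1\<close> drops out.\<close>

lemma out_degree_nns_join_left:
  assumes u: "u \<in> pverts G1"
  shows "real (out_degree (with_proj (nns_join G1 G2)) (Inl (Inl u))) = real n1 + real n2 - 1"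
proof -
  let ?N = "{w. (u, w) \<in> parcs G1}"
  have N: "?N \<subseteq> pverts G1 - {u}" using G1.in_arcsD2 G1.no_loops' by auto
  then have fin: "finite ?N" by (rule finite_subset) simp
  have "{w. (Inl (Inl u), w) \<in> parcs (nns_join G1 G2)}
      = (Inl \<circ> Inl) ` ?N \<union> (Inl \<circ> Inr) ` pverts G2 \<union> Inr ` (pverts G1 - {u} - ?N)"
    using u G1.arcs_symmetric by (auto simp: nns_join_def graph_join_def image_iff)
  also have "card \<dots> = card ?N + card (pverts G2) + card (pverts G1 - {u} - ?N)"
    using fin by (subst card_Un_disjoint card_image; (subst card_Un_disjoint)?) (auto simp: card_image inj_on_def)
  also have "\<dots> = n2 + card (pverts G1 - {u})"
    using fin n2 card_mono[OF _ N] by (simp add: card_Diff_subset[OF fin N] del: card_Diff_insert)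
  also have "card (pverts G1 - {u}) = n1 - 1" using u n1 by simp
  \<comment> \<open>Since \<open>u\<close> exists, \<open>n1\<close> is positive and the truncated
    \<open>n1 - 1\<close> agrees with the real difference.\<close>
  finally show ?thesis using u n1 G1.pair_finite_verts by (cases n1) (auto simp: out_degree_with_proj)
qed

lemma out_degree_nns_join_right:
  assumes x: "x \<in> pverts G2"
  shows "real (out_degree (with_proj (nns_join G1 G2)) (Inl (Inr x))) = real r2 + real n1"
proof -
  let ?N = "{w. (x, w) \<in> parcs G2}"
  have "?N \<subseteq> pverts G2" using G2.in_arcsD2 by auto
  then have fin: "finite ?N" by (rule finite_subset) simp
  have "{w. (Inl (Inr x), w) \<in> parcs (nns_join G1 G2)} = (Inl \<circ> Inr) ` ?N \<union> (Inl \<circ> Inl) ` pverts G1"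
    using x by (auto simp: nns_join_def graph_join_def image_iff)
  also have "card \<dots> = card ?N + card (pverts G1)"
    using fin by (subst card_Un_disjoint) (auto simp: card_image inj_on_def)
  finally show ?thesis using reg2 x n1 by (simp add: out_degree_with_proj regular_graph_def)
qed

lemma out_degree_nns_join_new:
  assumes u: "u \<in> pverts G1"
  shows "real (out_degree (with_proj (nns_join G1 G2)) (Inr u)) = real n1 - 1 - real r1"
proof -
  let ?N = "{w. (u, w) \<in> parcs G1}"
  have N: "?N \<subseteq> pverts G1 - {u}" using G1.in_arcsD2 G1.no_loops' by auto
  then have fin: "finite ?N" by (rule finite_subset) simp
  have "{w. (Inr u, w) \<in> parcs (nns_join G1 G2)} = (Inl \<circ> Inl) ` (pverts G1 - {u} - ?N)"
    using u by (auto simp: nns_join_def graph_join_def image_iff)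
  also have "card \<dots> = card (pverts G1 - {u} - ?N)" by (rule card_image) (auto simp: inj_on_def)
  also have "real \<dots> = real (card (pverts G1 - {u})) - real (card ?N)"
    using N fin card_mono[OF _ N] by (subst card_Diff_subset) auto
  also have "card ?N = r1" using reg1 u by (simp add: out_degree_with_proj regular_graph_def)
  also have "real (card (pverts G1 - {u})) = real n1 - 1"
    using u n1 G1.pair_finite_verts card_gt_0_iff[of "pverts G1"] by (auto simp: of_nat_diff)
  finally show ?thesis by (simp add: out_degree_with_proj)
qed

text \<open>The order is \<open>G1\<close>, then \<open>G2\<close>, then the new vertices; the last
  two are not adjacent to each other, so the block to be eliminated is block diagonal.
  \<open>Q1\<close> and \<open>Q2\<close> carry \<open>r1\<close> and \<open>r2\<close> on their
  diagonals: this explains the correction \<open>+ real r1\<close> in the first block and why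
  \<open>real n1\<close> alone is subtracted in the \<open>G2\<close> block. In \<open>B\<close> the
  shift \<open>1 - real r1\<close> makes the diagonal vanish.\<close>

lemma signless_laplacian_nns_join_block:
  fixes x :: real
  assumes vs1: "distinct vs1" "set vs1 = pverts G1" and vs2: "distinct vs2" "set vs2 = pverts G2"
  defines "Q1 \<equiv> signless_laplacian vs1 G1" and "Q2 \<equiv> signless_laplacian vs2 G2"
  defines "B \<equiv> ones_mat n1 n1 - ((1 - real r1) \<cdot>\<^sub>m 1\<^sub>m n1 + Q1)"
  shows "x \<cdot>\<^sub>m 1\<^sub>m (n1 + (n2 + n1))
      - signless_laplacian (map (Inl \<circ> Inl) vs1 @ map (Inl \<circ> Inr) vs2 @ map Inr vs1) (nns_join G1 G2)
    = four_block_mat ((x - (real n1 + real n2 - 1) + real r1) \<cdot>\<^sub>m 1\<^sub>m n1 - Q1)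
      (- four_block_mat (ones_mat n1 n2) B (0\<^sub>m 0 n2) (0\<^sub>m 0 n1))
      (- four_block_mat (ones_mat n2 n1) (0\<^sub>m n2 0) B (0\<^sub>m n1 0))
      (four_block_mat ((x - real n1) \<cdot>\<^sub>m 1\<^sub>m n2 - Q2) (0\<^sub>m n2 n1) (0\<^sub>m n1 n2)
        ((x - (real n1 - 1 - real r1)) \<cdot>\<^sub>m 1\<^sub>m n1))" (is "?L = ?R")
proof -
  have len: "length vs1 = n1" "length vs2 = n2" using vs1 vs2 n1 n2 by (metis distinct_card)+
  have dim: "dim_row Q1 = n1" "dim_col Q1 = n1" "dim_row Q2 = n2" "dim_col Q2 = n2"
    using signless_laplacian_carrier len unfolding Q1_def Q2_def by blast+
  let ?vs = "map (Inl \<circ> Inl) vs1 @ map (Inl \<circ> Inr) vs2 @ map Inr vs1 :: (('a + 'b) + 'a) list"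
  have mem1: "vs1 ! i \<in> pverts G1" if "i < n1" for i using that vs1 len nth_mem by blast
  have mem2: "vs2 ! i \<in> pverts G2" if "i < n2" for i using that vs2 len nth_mem by blast
  have Q1: "Q1 $$ (i, j) = (if i = j then real r1 else if (vs1 ! i, vs1 ! j) \<in> parcs G1 then 1 else 0)"
    if "i < n1" "j < n1" for i j
    using that len mem1[of i] reg1 G1.no_loops'
    by (auto simp: Q1_def signless_laplacian_def degree_mat_def adjacency_mat_def regular_graph_def)
  have Q2: "Q2 $$ (i, j) = (if i = j then real r2 else if (vs2 ! i, vs2 ! j) \<in> parcs G2 then 1 else 0)"
    if "i < n2" "j < n2" for i j
    using that len mem2[of i] reg2 G2.no_loops'
    by (auto simp: Q2_def signless_laplacian_def degree_mat_def adjacency_mat_def regular_graph_def)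
  have eq1: "vs1 ! i = vs1 ! j \<longleftrightarrow> i = j" if "i < n1" "j < n1" for i j
    using that vs1 len by (simp add: nth_eq_iff_index_eq)
  have B: "B $$ (i, j) = (if i \<noteq> j \<and> (vs1 ! i, vs1 ! j) \<notin> parcs G1 then 1 else 0)"
    if "i < n1" "j < n1" for i j
    using that Q1[OF that] dim by (auto simp: B_def)
  have dimB: "dim_row B = n1" "dim_col B = n1" using dim by (auto simp: B_def)
  have sym: "(v, u) \<in> parcs G1 \<longleftrightarrow> (u, v) \<in> parcs G1" for u v using G1.arcs_symmetric by blast
  have loops: "(u, u) \<notin> parcs G1" "(v, v) \<notin> parcs G2" for u v
    using G1.no_loops' G2.no_loops' by blast+
  show ?thesis
  proof (rule eq_matI)
    fix i j assume "i < dim_row ?R" "j < dim_col ?R"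
    then have ij: "i < n1 + (n2 + n1)" "j < n1 + (n2 + n1)" using dim by auto
    have L: "?L $$ (i, j) = (if i = j then x - real (out_degree (with_proj (nns_join G1 G2)) (?vs ! i)) else 0)
        - (if (?vs ! i, ?vs ! j) \<in> parcs (nns_join G1 G2) then 1 else 0)"
      using ij len by (auto simp: signless_laplacian_def degree_mat_def adjacency_mat_def)
    \<comment> \<open>Row and column index each lie in one of three ranges; the entries are compared
      in all nine blocks.\<close>
    consider "i < n1" | k where "i = n1 + k" "k < n2" | k where "i = n1 + (n2 + k)" "k < n1"
      using ij by (metis add_diff_inverse_nat nat_add_left_cancel_less)
    note i_cases = this
    consider "j < n1" | l where "j = n1 + l" "l < n2" | l where "j = n1 + (n2 + l)" "l < n1"
      using ij by (metis add_diff_inverse_nat nat_add_left_cancel_less)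
    note j_cases = this
    show "?L $$ (i, j) = ?R $$ (i, j)"
      unfolding L
      by (cases rule: i_cases; cases rule: j_cases;
          use len dim dimB mem1 mem2 in \<open>simp add: nth_append Q1 Q2 B eq1
            out_degree_nns_join_left out_degree_nns_join_right out_degree_nns_join_new\<close>;
          auto simp: nns_join_def graph_join_def mem1 mem2 eq1 sym loops)
  qed (use len dim signless_laplacian_carrier[of ?vs "nns_join G1 G2"] in auto)
qed

end

section \<open>Comparison of the characteristic polynomial with the claimed factors\<close>

lemma poly_eqI_gt:
  fixes p q :: "real poly"
  assumes "\<And>x. x > K \<Longrightarrow> poly p x = poly q x"
  shows "p = q"
proof (rule ccontr)
  assume "p \<noteq> q"
  then have "finite {x. poly (p - q) x = 0}" by (intro poly_roots_finite) simp
  moreover have "{K<..} \<subseteq> {x. poly (p - q) x = 0}" using assms by auto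
  ultimately show False using infinite_Ioi finite_subset by blast
qed

theorem theorem6p3:
  fixes G1 :: "'a pair_pre_digraph" and G2 :: "'b pair_pre_digraph"
    and r1 r2 n1 n2 :: nat
  assumes "pair_graph G1" and "pair_graph G2"
    and "regular_graph r1 G1" and "regular_graph r2 G2"
    and "card (pverts G1) = n1" and "card (pverts G2) = n2"
    and "n1 \<ge> 1" and "n2 \<ge> 1"
  shows "sl_spectrum (nns_join G1 G2) =
      {# real n1 + \<nu> G2 j. j \<in># mset_set {2..n2} #}
    + (\<Sum>i\<in>{2..n1}. proots
        [: (real n1)^2 - 2 * real r1 * real n1 - 2 * real n1 + real n1 * real n2
             - real r1 * real n2 - real n2 + 4 * real r1
             + \<nu> G1 i * (real n1 + real r1 - 3 - \<nu> G1 i),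
           2 * real r1 - 2 * real n1 - real n2 - \<nu> G1 i + 2,
           1 :])
    + proots
        [: 2 * real n1 * (real r1)^2 + 2 * real r1 * real n1 - 2 * real r1 * (real n1)^2
             - 2 * real r2 * real n1 * real n2 + 2 * real r1 * real r2 * real n2
             + 2 * real r2 * real n2 + 4 * real r2 * (real r1)^2 + 4 * real r1 * real r2
             - 4 * real r1 * real r2 * real n1,
           real n1 * real n2 - real n2 * real r1 - real n2 + 2 * (real n1)^2
             + 2 * real r1 * real n1 - 2 * real n1 - 2 * real r1 - 2 * (real r1)^2
             + 4 * real r2 * real n1 - 4 * real r2 + 2 * real r2 * real n2,
           2 - 3 * real n1 - real n2 - 2 * real r2,
           1 :]"
    (is "_ = _ + (\<Sum>i\<in>_. proots (?quad i)) + proots ?cubic")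
proof -
  interpret G1: pair_graph G1 by fact
  interpret G2: pair_graph G2 by fact
  let ?vs1 = "vertex_list G1" and ?vs2 = "vertex_list G2"
  let ?vs = "map (Inl \<circ> Inl) ?vs1 @ map (Inl \<circ> Inr) ?vs2 @ map Inr ?vs1 :: (('a + 'b) + 'a) list"
  let ?Q1 = "signless_laplacian ?vs1 G1" and ?Q2 = "signless_laplacian ?vs2 G2"
  let ?Q = "signless_laplacian ?vs (nns_join G1 G2)"
  note vs1 = vertex_list[OF G1.pair_finite_verts] and vs2 = vertex_list[OF G2.pair_finite_verts]
  note graph1 = assms(1,3,5,7) vs1 and graph2 = assms(2,4,6,8) vs2
  have len: "length ?vs1 = n1" "length ?vs2 = n2"
    using vs1 vs2 assms(5,6) by (metis distinct_card)+
  have carr: "?Q1 \<in> carrier_mat n1 n1" "?Q2 \<in> carrier_mat n2 n2"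
    using signless_laplacian_carrier[of ?vs1 G1] signless_laplacian_carrier[of ?vs2 G2] len by simp_all
  have carrQ: "?Q \<in> carrier_mat (n1 + (n2 + n1)) (n1 + (n2 + n1))"
    using signless_laplacian_carrier[of ?vs "nns_join G1 G2"] len by simp
  let ?lin = "\<lambda>j. [:- (real n1 + \<nu> G2 j), 1:]"
  let ?P = "(\<Prod>j\<in>{2..n2}. ?lin j) * (\<Prod>i\<in>{2..n1}. ?quad i) * ?cubic"
  have "char_poly ?Q = ?P"
  proof (rule poly_eqI_gt)
    \<comment> \<open>The bound is generous: it makes \<open>e\<close>, \<open>y\<close> and
      \<open>q s\<close> positive and the discriminant nonnegative, so every division and the real
      splitting below are legitimate.\<close>
    fix x :: real assume x: "x > real n1 + real n2 + 2 * real r1 + 2 * real r2 + 10"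
    \<comment> \<open>\<open>a\<close>, \<open>b\<close> and \<open>e\<close> are the scalars of the
      block form; \<open>y\<close> is the eigenvalue of \<open>?Z\<close> on the ones vector, and
      \<open>s\<close> is \<open>\<nu> G1 1\<close>.\<close>
    define a b e y s where "a = x - (real n1 + real n2 - 1) + real r1" and "b = 1 - real r1"
      and "e = x - (real n1 - 1 - real r1)" and "y = x - real n1 - 2 * real r2" and "s = 2 * real r1"
    note defs = a_def b_def e_def y_def s_def
    let ?B = "ones_mat n1 n1 - (b \<cdot>\<^sub>m 1\<^sub>m n1 + ?Q1)"
    let ?Z = "(x - real n1) \<cdot>\<^sub>m 1\<^sub>m n2 - ?Q2"
    define q where "q v = (a - v) * e - (b + v)\<^sup>2" for v
    have pos: "e > 0" "y > 0" "e + 4 * b + 4 * a \<ge> 0" using x by (auto simp: defs)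
    have "(1 + real r1) * (1 + real r1) < (a - s) * e"
      by (rule mult_strict_mono) (use x in \<open>auto simp: defs\<close>)
    moreover have "b + s = 1 + real r1" by (simp add: b_def s_def)
    ultimately have qs: "q s \<noteq> 0" unfolding q_def power2_eq_square by simp
    have Q2_ones: "?Q2 * ones_mat n2 n1 = (2 * real r2) \<cdot>\<^sub>m ones_mat n2 n1"
      by (rule mult_ones_mat[OF carr(2) signless_laplacian_row_sum[OF graph2]])
    have "?Z * ones_mat n2 n1 = (x - real n1) \<cdot>\<^sub>m 1\<^sub>m n2 * ones_mat n2 n1 - ?Q2 * ones_mat n2 n1"
      by (rule minus_mult_distrib_mat[of _ n2 n2]) (use carr in auto)
    also have "\<dots> = y \<cdot>\<^sub>m ones_mat n2 n1"
      unfolding Q2_ones mult_smult_assoc_mat[OF one_carrier_mat ones_mat_simps(1)]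
      by (intro eq_matI) (auto simp: y_def algebra_simps)
    finally have Z_ones: "?Z * ones_mat n2 n1 = y \<cdot>\<^sub>m ones_mat n2 n1" .
    \<comment> \<open>The determinant is the characteristic polynomial of \<open>?Q2\<close> at
      \<open>x - real n1\<close>; the factor of index 1 is \<open>y\<close>, because
      \<open>\<nu> G2 1 = 2 * real r2\<close>.\<close>
    have detZ: "det ?Z = y * (\<Prod>j\<in>{2..n2}. poly (?lin j) x)"
      unfolding poly_char_poly_eq_det[OF carr(2), symmetric] poly_char_poly_signless_laplacian[OF graph2]
      using assms(8) sl_eigenvalue_1_regular[OF graph2]
      by (subst prod.atLeast_Suc_atMost) (auto simp: y_def numeral_2_eq_2 algebra_simps)
    let ?S = "a \<cdot>\<^sub>m 1\<^sub>m n1 - ?Q1 - (real n2 / y) \<cdot>\<^sub>m ones_mat n1 n1 - (1 / e) \<cdot>\<^sub>m (?B * ?B)"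
    have "poly (char_poly ?Q) x = det (x \<cdot>\<^sub>m 1\<^sub>m (n1 + (n2 + n1)) - ?Q)"
      by (rule poly_char_poly_eq_det[OF carrQ])
    also have "\<dots> = e ^ n1 * det ?Z * det ?S"
      unfolding signless_laplacian_nns_join_block[OF assms(1-6) vs1 vs2] a_def[symmetric] b_def[symmetric] e_def[symmetric]
      by (rule det_nns_block) (use carr Z_ones pos in auto)
    finally have 1: "poly (char_poly ?Q) x = (\<Prod>j\<in>{2..n2}. poly (?lin j) x) * (y * (e ^ n1 * det ?S))"
      unfolding detZ by simp
    have q_quad: "q (\<nu> G1 i) = poly (?quad i) x" for i
      by (simp add: q_def defs power2_eq_square algebra_simps)
    have "e ^ n1 * det ?S * q s
        = (\<Prod>i\<in>{1..n1}. q (\<nu> G1 i)) * (q s - (real n2 / y * e + (n1 - 2 * b - 2 * s)) * n1)"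
      by (rule det_nns_schur_complement[OF carr(1)])
        (use signless_laplacian_row_sum[OF graph1] signless_laplacian_col_sum[OF graph1]
          poly_char_poly_signless_laplacian[OF graph1] pos qs q_def s_def in auto)
    \<comment> \<open>The factor of index 1 is \<open>q s\<close>, which cancels the
      \<open>q s\<close> on the left.\<close>
    also have "(\<Prod>i\<in>{1..n1}. q (\<nu> G1 i)) = q s * (\<Prod>i\<in>{2..n1}. poly (?quad i) x)"
      unfolding q_quad[symmetric] using assms(7) sl_eigenvalue_1_regular[OF graph1]
      by (subst prod.atLeast_Suc_atMost) (auto simp: s_def numeral_2_eq_2)
    finally have 2: "e ^ n1 * det ?S = (\<Prod>i\<in>{2..n1}. poly (?quad i) x)
        * (q s - (real n2 / y * e + (n1 - 2 * b - 2 * s)) * n1)"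
      using qs by simp
    \<comment> \<open>The cubic joins what is left at index 1 of both graphs: \<open>y\<close> from
      \<open>G2\<close> and the perturbed \<open>q s\<close> from \<open>G1\<close>. Multiplying by
      \<open>y\<close> clears \<open>real n2 / y\<close>.\<close>
    have "y * (q s - (real n2 / y * e + (n1 - 2 * b - 2 * s)) * n1)
        = y * q s - (real n2 * e + y * (n1 - 2 * b - 2 * s)) * n1"
      using pos by (simp add: field_simps)
    also have "\<dots> = poly ?cubic x"
      by (simp add: q_def defs power2_eq_square algebra_simps)
    finally have 3: "y * (q s - (real n2 / y * e + (n1 - 2 * b - 2 * s)) * n1) = poly ?cubic x" .
    have "poly (char_poly ?Q) x = (\<Prod>j\<in>{2..n2}. poly (?lin j) x) * (\<Prod>i\<in>{2..n1}. poly (?quad i) x)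
        * (y * (q s - (real n2 / y * e + (n1 - 2 * b - 2 * s)) * n1))"
      unfolding 1 2 by (simp only: mult_ac)
    then show "poly (char_poly ?Q) x = poly ?P x"
      unfolding 3 poly_mult poly_prod .
  qed
  \<comment> \<open>The spectrum does not depend on the enumeration (\<open>sl_spectrum_eq\<close>),
    so it may be read off in the order that gives the block form.\<close>
  moreover have "distinct ?vs" using vs1 vs2 by (auto simp: distinct_map inj_on_def)
  moreover have "set ?vs = pverts (nns_join G1 G2)"
    using vs1 vs2 by (auto simp: nns_join_def graph_join_def)
  ultimately have "sl_spectrum (nns_join G1 G2) = proots ?P"
    using sl_spectrum_eq[of ?vs "nns_join G1 G2"] by simp
  also have "\<dots> = proots (\<Prod>j\<in>{2..n2}. ?lin j) + proots (\<Prod>i\<in>{2..n1}. ?quad i) + proots ?cubic"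
  proof -
    \<comment> \<open>\<open>proots\<close> is additive only over nonzero factors, as
      \<open>proots 0\<close> is empty by convention; here all leading coefficients are 1.\<close>
    have "(\<Prod>j\<in>{2..n2}. ?lin j) \<noteq> 0" "(\<Prod>i\<in>{2..n1}. ?quad i) \<noteq> 0" by simp_all
    moreover from this have "(\<Prod>j\<in>{2..n2}. ?lin j) * (\<Prod>i\<in>{2..n1}. ?quad i) \<noteq> 0"
      by (simp only: mult_eq_0_iff simp_thms)
    moreover have "?cubic \<noteq> 0" by simp
    ultimately show ?thesis by (simp only: proots_mult not_False_eq_True)
  qed
  also have "proots (\<Prod>j\<in>{2..n2}. ?lin j) = (\<Sum>j\<in>{2..n2}. proots (?lin j))"
    by (rule proots_prod) simp
  also have "proots (\<Prod>i\<in>{2..n1}. ?quad i) = (\<Sum>i\<in>{2..n1}. proots (?quad i))"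
    by (rule proots_prod) simp
  also have "(\<Sum>j\<in>{2..n2}. proots (?lin j)) = {# real n1 + \<nu> G2 j. j \<in># mset_set {2..n2} #}"
    by (simp add: sum_unfold_sum_mset add.commute)
  finally show ?thesis .
qed

end
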